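(* For every $(g,f,F)\in\Omega=\{(g,f,F)\in\mathbb R^3: F\ge|f|\}$ one has $$\mathcal B(g,f,F)=B(g,f,F),$$ where $$\mathcal B(g,f,F)=\sup\big|\{x\in I_0:\psi(x)\ge 0\}\big|,$$ the supremum being over all functions $\varphi$ on $I_0$ with $\langle|\varphi|\rangle_{I_0}=F$, $\langle\varphi\rangle_{I_0}=f$ and all martingale transforms $\psi$ of $\varphi$ with $\langle\psi\rangle_{I_0}=g$, and $$B(g,f,F)=\begin{cases}1,&-g\le F,\\ 1-\dfrac{(g+F)^2}{g^2-f^2},&-g>F.\end{cases}$$
   Context: $I_0=[0,1]$; $D$ is the collection of dyadic intervals; $|\cdot|$ applied to sets is Lebesgue measure. For a dyadic interval $I$ with left half $I_-$ and right half $I_+$, the Haar function is $h_I=|I|^{-1/2}$ on $I_+$, $h_I=-|I|^{-1/2}$ on $I_-$, and $0$ off $I$. $(\varphi,h_I)=\int\varphi h_I$, and $\langle\varphi\rangle_J=\frac1{|J|}\int_J\varphi$. All functions are real-valued and integrable on $I_0$. A function $\psi$ is a martingale transform of $\varphi$ if for some family $\{\varepsilon_I\}$ with $\varepsilon_I\in\{-1,1\}$, $$\psi(x)=\langle\psi\rangle_{I_0}+\sum_{I\subset I_0,\ I\in D}\varepsilon_I(\varphi,h_I)h_I(x),\qquad x\in I_0$$ (a.e., with the sum being the limit of partial sums over $|I|\ge2^{-n}$; equivalently $|(\psi,h_I)|=|(\varphi,h_I)|$ for every dyadic $I\subset I_0$). *)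

theory Defs
  imports "HOL-Analysis.Analysis"
begin

abbreviation I0 :: "real set" where
  "I0 \<equiv> {0..1}"

abbreviation len :: "real set \<Rightarrow> real" where
  "len A \<equiv> measure lebesgue A"

definition avg :: "real set \<Rightarrow> (real \<Rightarrow> real) \<Rightarrow> real" where
  "avg J \<phi> = (1 / len J) * (LINT x:J|lebesgue. \<phi> x)"

text \<open>Dyadic intervals of all scales, taken half-open; the choice of endpoints only affects
  Haar functions on null sets.\<close>

definition dyadic :: "real set set" where
  "dyadic = {{real_of_int k * 2 powi j ..< (real_of_int k + 1) * 2 powi j} | k j. True}"

definition midpt :: "real set \<Rightarrow> real" where
  "midpt I = (Inf I + Sup I) / 2"

definition left_half :: "real set \<Rightarrow> real set" where
  "left_half I = {x \<in> I. x < midpt I}"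

definition right_half :: "real set \<Rightarrow> real set" where
  "right_half I = {x \<in> I. midpt I \<le> x}"

definition haar :: "real set \<Rightarrow> real \<Rightarrow> real" where
  "haar I x =
     (if x \<in> right_half I then 1 / sqrt (len I)
      else if x \<in> left_half I then - (1 / sqrt (len I))
      else 0)"

definition haar_coeff :: "(real \<Rightarrow> real) \<Rightarrow> real set \<Rightarrow> real" where
  "haar_coeff \<phi> I = (LINT x:I0|lebesgue. \<phi> x * haar I x)"

definition dyadic_upto :: "nat \<Rightarrow> real set set" where
  "dyadic_upto n = {I \<in> dyadic. I \<subseteq> I0 \<and> len I \<ge> 1 / 2 ^ n}"

text \<open>The sum over \<open>dyadic_upto n\<close> in the next definition is a genuine finite sum:\<close>

lemma dyadic_upto_eq:
  "dyadic_upto n =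
     (\<lambda>(j, k). {real k / 2 ^ j ..< (real k + 1) / 2 ^ j}) ` (SIGMA j:{..n}. {..<2 ^ j})"
proof (intro equalityI subsetI)
  fix I assume "I \<in> dyadic_upto n"
  then obtain k :: int and j :: int
    where I: "I = {real_of_int k * 2 powi j ..< (real_of_int k + 1) * 2 powi j}"
      and sub: "I \<subseteq> I0" and long: "len I \<ge> 1 / 2 ^ n"
    by (auto simp: dyadic_upto_def dyadic_def)
  let ?d = "(2 :: real) powi j"
  have d: "?d > 0" by simp
  have lt: "real_of_int k * ?d < (real_of_int k + 1) * ?d"
    using d by (simp add: algebra_simps)
  have lenI: "len I = ?d"
    using lt by (simp add: I algebra_simps)
  have "real_of_int k * ?d \<in> I" using lt by (simp add: I)
  then have "0 \<le> real_of_int k * ?d" using sub by auto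
  then have k0: "k \<ge> 0" using d by (simp add: zero_le_mult_iff)
  have "closure I \<subseteq> I0" using sub by (simp add: closure_minimal)
  then have top: "(real_of_int k + 1) * ?d \<le> 1"
    using lt by (auto simp: I)
  have "1 * ?d \<le> (real_of_int k + 1) * ?d" using k0 d by (intro mult_right_mono) auto
  then have "?d \<le> 1" using top by linarith
  then have j0: "j \<le> 0"
    using power_int_strict_increasing[of 0 j "2::real"] by (cases "j \<le> 0") auto
  define i where "i = nat (- j)"
  have ji: "?d = 1 / 2 ^ i"
    using j0 by (simp add: i_def power_int_def inverse_eq_divide power_one_over)
  have "(1::real) / 2 ^ i \<ge> 1 / 2 ^ n" using long lenI ji by simp
  then have "(2::real) ^ i \<le> 2 ^ n" by (simp add: field_simps)
  then have "i \<le> n" by simp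
  moreover have "nat k < 2 ^ i"
  proof -
    have "real_of_int k + 1 \<le> 2 ^ i" using top ji by (simp add: field_simps)
    then have "real_of_int (k + 1) \<le> real_of_int (2 ^ i)" by simp
    then have "k + 1 \<le> 2 ^ i" by (simp only: of_int_le_iff)
    then show ?thesis using k0 by (simp add: nat_less_iff)
  qed
  moreover have "I = {real (nat k) / 2 ^ i ..< (real (nat k) + 1) / 2 ^ i}"
    using k0 by (simp add: I ji)
  ultimately show "I \<in> (\<lambda>(j, k). {real k / 2 ^ j ..< (real k + 1) / 2 ^ j}) `
      (SIGMA j:{..n}. {..<2 ^ j})"
    by (intro image_eqI[of _ _ "(i, nat k)"]) auto
next
  fix I assume "I \<in> (\<lambda>(j, k). {real k / 2 ^ j ..< (real k + 1) / 2 ^ j}) `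
      (SIGMA j:{..n}. {..<2 ^ j})"
  then obtain j k :: nat where I: "I = {real k / 2 ^ j ..< (real k + 1) / 2 ^ j}"
    and j: "j \<le> n" and k: "k < 2 ^ j"
    by auto
  have "I = {real_of_int (int k) * 2 powi (- int j) ..<
             (real_of_int (int k) + 1) * 2 powi (- int j)}"
    by (simp add: I power_int_minus divide_inverse)
  then have "I \<in> dyadic" unfolding dyadic_def by blast
  moreover have "I \<subseteq> I0"
  proof -
    have "real (k + 1) \<le> real (2 ^ j)" using k by (intro of_nat_mono) simp
    then have "(real k + 1) / 2 ^ j \<le> 1" by simp
    moreover have "0 \<le> real k / 2 ^ j" by simp
    ultimately show ?thesis unfolding I by (smt (verit) atLeastLessThan_iff atLeastAtMost_iff subsetI)
  qed
  moreover have "len I = 1 / 2 ^ j"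
    by (simp add: I divide_right_mono flip: diff_divide_distrib)
  moreover have "(1::real) / 2 ^ n \<le> 1 / 2 ^ j"
    using j by (intro divide_left_mono power_increasing) auto
  ultimately show "I \<in> dyadic_upto n" by (simp add: dyadic_upto_def)
qed

lemma finite_dyadic_upto: "finite (dyadic_upto n)"
  by (simp add: dyadic_upto_eq)

definition martingale_transform :: "(real \<Rightarrow> real) \<Rightarrow> (real \<Rightarrow> real) \<Rightarrow> bool" where
  "martingale_transform \<phi> \<psi> \<longleftrightarrow>
     set_integrable lebesgue I0 \<phi> \<and> set_integrable lebesgue I0 \<psi> \<and>
     (\<exists>\<epsilon> :: real set \<Rightarrow> real.
        (\<forall>I\<in>dyadic. I \<subseteq> I0 \<longrightarrow> \<epsilon> I \<in> {-1, 1}) \<and>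
        (AE x\<in>I0 in lebesgue.
           (\<lambda>n. avg I0 \<psi> + (\<Sum>I\<in>dyadic_upto n. \<epsilon> I * haar_coeff \<phi> I * haar I x))
             \<longlonglongrightarrow> \<psi> x))"

definition Omega :: "(real \<times> real \<times> real) set" where
  "Omega = {(g, f, F). F \<ge> \<bar>f\<bar>}"

text \<open>A supremum of reals: the set is bounded above by \<open>1\<close>, and it is nonempty
  for \<open>(g, f, F) \<in> Omega\<close> (take \<open>\<phi>\<close> equal to \<open>f - F\<close> and \<open>f + F\<close> on the two halves of
  \<open>I0\<close>, and \<open>\<psi> = \<phi> - f + g\<close>).\<close>

definition bellman :: "real \<Rightarrow> real \<Rightarrow> real \<Rightarrow> real" where
  "bellman g f F =
     Sup {len {x \<in> I0. \<psi> x \<ge> 0} | \<phi> \<psi>.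
            martingale_transform \<phi> \<psi> \<and>
            avg I0 (\<lambda>x. \<bar>\<phi> x\<bar>) = F \<and> avg I0 \<phi> = f \<and> avg I0 \<psi> = g}"

definition B :: "real \<Rightarrow> real \<Rightarrow> real \<Rightarrow> real" where
  "B g f F = (if - g \<le> F then 1 else 1 - (g + F)\<^sup>2 / (g\<^sup>2 - f\<^sup>2))"

end

theory Submission imports Defs begin

text \<open>The function \<open>B\<close> satisfies the midpoint inequality for steps with \<open>\<bar>\<Delta>g\<bar> = \<bar>\<Delta>f\<bar>\<close>, so its
  average over the cells of generation \<open>n\<close>, evaluated at the partial sums of \<open>\<psi>\<close> and at the means
  of \<open>\<phi>\<close> and \<open>\<bar>\<phi>\<bar>\<close>, decreases in \<open>n\<close>. Since \<open>B = 1\<close> wherever \<open>g \<ge> 0\<close>, this bounds the measure of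
  the set where a partial sum is nonnegative; only the almost everywhere convergence of the partial
  sums is needed to pass to \<open>\<psi>\<close>, after raising \<open>g\<close> by a small \<open>\<delta>\<close>.

  Conversely, let \<open>V\<close> be the supremum over simple functions, that is, over finite dyadic trees. It
  satisfies the same midpoint inequality and is bounded, hence is concave along all segments with
  \<open>\<bar>\<Delta>g\<bar> = \<bar>\<Delta>f\<bar>\<close>. Concavity along a ray, together with \<open>V \<ge> 0\<close>, gives \<open>V = 1\<close> on \<open>- g \<le> F\<close>, and
  concavity along the segments on which \<open>B\<close> is affine gives \<open>V \<ge> B\<close> elsewhere.\<close>

section \<open>Dyadic averages and Haar sums\<close>

text \<open>Indexing by generation and position turns the dyadic tree into arithmetic: cell
  \<open>k\<close> has children \<open>2 * k\<close> and \<open>2 * k + 1\<close> and parent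
  \<open>k div 2\<close>.\<close>

definition dint :: "nat \<Rightarrow> nat \<Rightarrow> real set" where
  "dint n k = {real k / 2 ^ n ..< (real k + 1) / 2 ^ n}"

lemma len_dint: "len (dint n k) = 1 / 2 ^ n"
  by (simp add: dint_def divide_right_mono flip: diff_divide_distrib)

lemma dint_measurable [measurable]: "dint n k \<in> sets lebesgue"
  by (simp add: dint_def)

lemma dint_lmeasurable: "dint n k \<in> lmeasurable"
proof (rule bounded_set_imp_lmeasurable)
  show "bounded (dint n k)"
    unfolding dint_def by (rule bounded_subset[OF bounded_closed_interval atLeastLessThan_subseteq_atLeastAtMost_iff[THEN iffD2]]) auto
qed simp

lemma midpt_dint: "midpt (dint n k) = (2 * real k + 1) / 2 ^ Suc n"
proof -
  have "real k / 2 ^ n < (real k + 1) / 2 ^ n"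
    by (simp add: divide_strict_right_mono)
  then show ?thesis
    by (simp add: midpt_def dint_def field_simps)
qed

lemma left_half_dint: "left_half (dint n k) = dint (Suc n) (2 * k)"
  unfolding left_half_def midpt_dint by (auto simp: dint_def field_simps)

lemma right_half_dint: "right_half (dint n k) = dint (Suc n) (2 * k + 1)"
  unfolding right_half_def midpt_dint by (auto simp: dint_def field_simps)

lemma dint_halves:
  "dint n k = dint (Suc n) (2 * k) \<union> dint (Suc n) (2 * k + 1)"
  "dint (Suc n) (2 * k) \<inter> dint (Suc n) (2 * k + 1) = {}"
  by (auto simp: dint_def field_simps)

lemma mem_dint_iff: "x \<in> dint n k \<longleftrightarrow> 0 \<le> x \<and> k = nat \<lfloor>2 ^ n * x\<rfloor>"
proof -
  have "x \<in> dint n k \<longleftrightarrow> real k \<le> 2 ^ n * x \<and> 2 ^ n * x < real k + 1"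
    by (auto simp: dint_def field_simps)
  also have "\<dots> \<longleftrightarrow> \<lfloor>2 ^ n * x\<rfloor> = int k"
    by (simp add: floor_eq_iff)
  also have "\<dots> \<longleftrightarrow> 0 \<le> x \<and> k = nat \<lfloor>2 ^ n * x\<rfloor>"
    by (auto simp: zero_le_mult_iff dest: sym) (metis of_nat_0_le_iff zero_le_floor zero_le_mult_iff not_less zero_less_power zero_less_numeral)
  finally show ?thesis .
qed

lemma dint_disjoint: "k \<noteq> l \<Longrightarrow> dint n k \<inter> dint n l = {}"
  by (auto simp: mem_dint_iff)

lemma dint_parent: "x \<in> dint (Suc n) k \<Longrightarrow> x \<in> dint n (k div 2)"
  using dint_halves(1)[of n "k div 2"] by (cases "even k") (auto elim!: oddE evenE)

lemma union_dint: "(\<Union>k<2 ^ n. dint n k) = {0..<1}"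
proof -
  have "nat \<lfloor>2 ^ n * x\<rfloor> < 2 ^ n \<longleftrightarrow> x < 1" if "0 \<le> x" for x :: real
  proof -
    have "nat \<lfloor>2 ^ n * x\<rfloor> < 2 ^ n \<longleftrightarrow> \<lfloor>2 ^ n * x\<rfloor> < 2 ^ n"
      using that by (subst nat_less_iff) auto
    also have "\<dots> \<longleftrightarrow> 2 ^ n * x < 2 ^ n"
      by (subst floor_less_iff) simp
    finally show ?thesis by simp
  qed
  then show ?thesis by (auto simp: mem_dint_iff)
qed

lemma dint_subset: "k < 2 ^ n \<Longrightarrow> dint n k \<subseteq> {0..<1}"
  using union_dint[of n] by blast

lemma dint_subset_I0: "k < 2 ^ n \<Longrightarrow> dint n k \<subseteq> I0"
  using dint_subset[of k n] by auto

lemma dint_in_dyadic: "dint n k \<in> dyadic"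
proof -
  have "dint n k = {real_of_int (int k) * 2 powi (- int n) ..<
             (real_of_int (int k) + 1) * 2 powi (- int n)}"
    by (simp add: dint_def power_int_minus divide_inverse)
  then show ?thesis unfolding dyadic_def by blast
qed

lemma inj_dint: "inj (dint n)"
proof
  fix k l assume "dint n k = dint n l"
  moreover have "real k / 2 ^ n \<in> dint n k"
    by (simp add: dint_def divide_strict_right_mono)
  ultimately show "k = l" using dint_disjoint by blast
qed

lemma dyadic_upto_0: "dyadic_upto 0 = {dint 0 0}"
proof -
  have "(SIGMA j:{..0}. {..<2 ^ j}) = {(0 :: nat, 0 :: nat)}" by auto
  then show ?thesis by (simp add: dyadic_upto_eq dint_def)
qed

lemma dyadic_upto_Suc:
  "dyadic_upto (Suc n) = dyadic_upto n \<union> dint (Suc n) ` {..<2 ^ Suc n}"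
  unfolding dyadic_upto_eq dint_def atMost_Suc by (auto simp: image_iff)

lemma dyadic_upto_new:
  "dyadic_upto n \<inter> dint (Suc n) ` {..<2 ^ Suc n} = {}"
  by (auto simp: dyadic_upto_def len_dint field_simps)

lemma dyadic_upto_cases: "I \<in> dyadic_upto n \<Longrightarrow> \<exists>j k. k < 2 ^ j \<and> I = dint j k"
  by (auto simp: dyadic_upto_eq dint_def)

lemma haar_dint:
  "haar (dint n k) x =
     (if x \<in> dint (Suc n) (2 * k + 1) then sqrt (2 ^ n)
      else if x \<in> dint (Suc n) (2 * k) then - sqrt (2 ^ n) else 0)"
  by (simp add: haar_def right_half_dint left_half_dint len_dint real_sqrt_divide)

lemma haar_outside: "x \<notin> dint n k \<Longrightarrow> haar (dint n k) x = 0"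
  using dint_halves(1)[of n k] unfolding haar_dint by auto

text \<open>The sum telescopes: in each generation only the cell containing \<open>x\<close>
  contributes, and its term is the increment of \<open>m\<close> towards the child containing
  \<open>x\<close>. Intervals up to generation \<open>n\<close> describe jumps into generation
  \<open>n + 1\<close>, hence \<open>Suc n\<close>. With abstract \<open>m\<close> and
  \<open>c\<close> this covers both the raised partial sums of the upper bound and the true means of
  the constructed step functions.\<close>

lemma haar_sum:
  fixes m :: "nat \<Rightarrow> nat \<Rightarrow> real" and c :: "real set \<Rightarrow> real"
  assumes step: "\<And>n k. k < 2 ^ Suc n \<Longrightarrow> m (Suc n) k - m n (k div 2) =
      (if odd k then 1 else - 1) * c (dint n (k div 2)) * sqrt (2 ^ n)"
    and "k < 2 ^ Suc n" "x \<in> dint (Suc n) k"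
  shows "m 0 0 + (\<Sum>I\<in>dyadic_upto n. c I * haar I x) = m (Suc n) k"
  using assms(2,3)
proof (induction n arbitrary: k)
  have haar_val: "haar (dint n (k div 2)) x = (if odd k then 1 else - 1) * sqrt (2 ^ n)"
    if "x \<in> dint (Suc n) k" for n k
    using that dint_disjoint[of k "2 * (k div 2) + 1" "Suc n"]
    by (cases "even k") (auto simp: haar_dint elim!: evenE oddE)
  {
    case 0
    then have "k div 2 = 0" by simp
    then show ?case
      using step[of k 0] haar_val[where k = k and n = 0] 0 by (cases "even k") (simp_all add: dyadic_upto_0)
  next
    case (Suc n)
    let ?l = "k div 2"
    have l: "?l < 2 ^ Suc n" using Suc.prems by auto
    have xl: "x \<in> dint (Suc n) ?l" using Suc.prems dint_parent by blast
    have "(\<Sum>I\<in>dint (Suc n) ` {..<2 ^ Suc n}. c I * haar I x)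
        = (\<Sum>i<2 ^ Suc n. c (dint (Suc n) i) * haar (dint (Suc n) i) x)"
      using inj_dint by (subst sum.reindex) (auto intro: inj_on_subset)
    also have "\<dots> = (\<Sum>i\<in>{?l}. c (dint (Suc n) i) * haar (dint (Suc n) i) x)"
    proof (intro sum.mono_neutral_right)
      show "\<forall>i\<in>{..<2 ^ Suc n} - {?l}. c (dint (Suc n) i) * haar (dint (Suc n) i) x = 0"
      proof
        fix i assume "i \<in> {..<2 ^ Suc n} - {?l}"
        then have "x \<notin> dint (Suc n) i" using dint_disjoint xl by blast
        then show "c (dint (Suc n) i) * haar (dint (Suc n) i) x = 0"
          by (simp add: haar_outside)
      qed
    qed (use l in auto)
    also have "\<dots> = m (Suc (Suc n)) k - m (Suc n) ?l"
      using step[OF Suc.prems(1)] haar_val[OF Suc.prems(2)] by simp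
    finally show ?case
      unfolding dyadic_upto_Suc using Suc.IH[OF l xl] dyadic_upto_new[of n]
      by (subst sum.union_disjoint) (auto simp: finite_dyadic_upto)
  }
qed

section \<open>Means over dyadic cells and their relation to Haar coefficients\<close>

definition mean :: "(real \<Rightarrow> real) \<Rightarrow> nat \<Rightarrow> nat \<Rightarrow> real" where
  "mean \<phi> n k = 2 ^ n * (LINT x:dint n k|lebesgue. \<phi> x)"

lemma set_integrable_dint:
  fixes \<phi> :: "real \<Rightarrow> real"
  assumes "set_integrable lebesgue I0 \<phi>" "k < 2 ^ n"
  shows "set_integrable lebesgue (dint n k) \<phi>"
  by (rule set_integrable_subset[OF assms(1)]) (auto simp: dint_subset_I0 assms(2))

lemma mean_halves:
  assumes "set_integrable lebesgue I0 \<phi>" "k < 2 ^ n"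
  shows "mean \<phi> n k = (mean \<phi> (Suc n) (2 * k) + mean \<phi> (Suc n) (2 * k + 1)) / 2"
  unfolding mean_def dint_halves(1)[of n k] using assms
  by (subst set_integral_Un[OF dint_halves(2)]) (simp_all add: set_integrable_dint algebra_simps)

text \<open>The half-open cells miss only the right endpoint of \<open>I0\<close>, a null
  set.\<close>

lemma AE_I0: "AE x in lebesgue. x \<in> I0 \<longleftrightarrow> x \<in> {0..<1}"
proof -
  have "AE x in lebesgue. x \<noteq> (1::real)"
    by (rule AE_completion[OF AE_lborel_singleton])
  then show ?thesis by eventually_elim auto
qed

lemma avg_I0: "avg I0 \<phi> = mean \<phi> 0 0"
proof -
  have "(LINT x:I0|lebesgue. \<phi> x) = (LINT x:{0..<1}|lebesgue. \<phi> x)"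
    by (rule set_integral_discrete_difference[where X = "{1}"]) (auto simp: emeasure_lborel_singleton)
  then show ?thesis by (simp add: avg_def mean_def dint_def)
qed

text \<open>Since \<open>sqrt (2 ^ n)\<close> is the height of the Haar function, the product is the
  jump of the mean: it is added on the right child and subtracted on the left one.\<close>

lemma haar_coeff_dint:
  assumes "set_integrable lebesgue I0 \<phi>" "k < 2 ^ n"
  shows "haar_coeff \<phi> (dint n k) * sqrt (2 ^ n) =
     (mean \<phi> (Suc n) (2 * k + 1) - mean \<phi> (Suc n) (2 * k)) / 2"
proof -
  have lt: "2 * k < 2 ^ Suc n" "2 * k + 1 < 2 ^ Suc n" using assms(2) by auto
  let ?L = "dint (Suc n) (2 * k)" and ?R = "dint (Suc n) (2 * k + 1)"
  have "indicator I0 x *\<^sub>R (\<phi> x * haar (dint n k) x) =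
      sqrt (2 ^ n) * (indicator ?R x *\<^sub>R \<phi> x) - sqrt (2 ^ n) * (indicator ?L x *\<^sub>R \<phi> x)" for x
    using dint_subset_I0[OF lt(1)] dint_subset_I0[OF lt(2)] dint_halves(2)[of n k]
    by (auto simp: haar_dint indicator_def)
  then have "haar_coeff \<phi> (dint n k) =
      sqrt (2 ^ n) * (LINT x:?R|lebesgue. \<phi> x) - sqrt (2 ^ n) * (LINT x:?L|lebesgue. \<phi> x)"
    using set_integrable_dint[OF assms(1) lt(1)] set_integrable_dint[OF assms(1) lt(2)]
    by (simp add: haar_coeff_def set_lebesgue_integral_def set_integrable_def)
  moreover have "c * s = s * s * (r - l)" if "c = s * r - s * l" for c s r l :: real
    unfolding that by (simp add: algebra_simps)
  ultimately have "haar_coeff \<phi> (dint n k) * sqrt (2 ^ n) = sqrt (2 ^ n) * sqrt (2 ^ n) *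
      ((LINT x:?R|lebesgue. \<phi> x) - (LINT x:?L|lebesgue. \<phi> x))"
    by blast
  also have "sqrt (2 ^ n) * sqrt (2 ^ n) = (2 :: real) ^ n" by simp
  finally show ?thesis
    by (simp only: mean_def power_Suc) argo
qed

section \<open>The explicit Bellman function\<close>

text \<open>This is the deficit \<open>1 - B\<close> after the substitution \<open>G = - g\<close>;
  the nontrivial region becomes \<open>G > F\<close>, and concavity of \<open>B\<close> becomes
  convexity.\<close>

definition excess :: "real \<Rightarrow> real \<Rightarrow> real \<Rightarrow> real" where
  "excess G f F = (if G \<le> F then 0 else (G - F)\<^sup>2 / (G\<^sup>2 - f\<^sup>2))"

lemma B_excess: "B g f F = 1 - excess (- g) f F"
  by (simp add: B_def excess_def power2_commute[of g F] power2_eq_square algebra_simps)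

lemma excess_uminus: "excess G (- f) F = excess G f F"
  by (simp add: excess_def)

lemma excess_nonneg: "\<bar>f\<bar> \<le> F \<Longrightarrow> 0 \<le> excess G f F"
  by (auto simp: excess_def power2_le_iff_abs_le intro!: divide_nonneg_nonneg)

lemma excess_le_1:
  assumes "\<bar>f\<bar> \<le> F"
  shows "excess G f F \<le> 1"
proof (cases "G \<le> F")
  case False
  have "(G - F)\<^sup>2 \<le> (G - \<bar>f\<bar>)\<^sup>2" using False assms by (intro power_mono) auto
  also have "\<dots> \<le> (G - \<bar>f\<bar>) * (G + \<bar>f\<bar>)"
    unfolding power2_eq_square using False assms by (intro mult_left_mono) auto
  also have "\<dots> = G\<^sup>2 - f\<^sup>2" by (simp add: algebra_simps power2_eq_square flip: abs_mult)
  finally have "(G - F)\<^sup>2 \<le> G\<^sup>2 - f\<^sup>2" .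
  moreover have "0 < (G - F)\<^sup>2" using False by simp
  ultimately have "0 < G\<^sup>2 - f\<^sup>2" "(G - F)\<^sup>2 \<le> G\<^sup>2 - f\<^sup>2" by linarith+
  then show ?thesis using False
    by (simp only: excess_def if_False divide_le_eq_1_pos)
qed (simp add: excess_def)

text \<open>On a hyperplane where \<open>G + f\<close> is constant, the function \<open>excess\<close> is the supremum of
  these affine functions over \<open>c \<in> [0, 1]\<close>.\<close>

lemma excess_ge_affine:
  assumes "\<bar>f\<bar> \<le> F" "0 < G + f" "0 \<le> c" "c \<le> 1"
  shows "(2 * c * (G - F) - c\<^sup>2 * (G - f)) / (G + f) \<le> excess G f F"
proof (cases "G \<le> F")
  case True
  have "2 * c * (G - F) - c\<^sup>2 * (G - f) \<le> 0"
  proof (cases "G \<le> f")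
    case True
    have "2 * c * (G - F) - c\<^sup>2 * (G - f) \<le> 2 * c * (G - f) - c\<^sup>2 * (G - f)"
      using assms by (intro diff_right_mono mult_left_mono) auto
    also have "\<dots> = c * (2 - c) * (G - f)" by (simp add: algebra_simps power2_eq_square)
    also have "\<dots> \<le> 0" using True assms by (intro mult_nonneg_nonpos) auto
    finally show ?thesis .
  next
    case False
    have "2 * c * (G - F) \<le> 0" using \<open>G \<le> F\<close> assms by (intro mult_nonneg_nonpos) auto
    moreover have "0 \<le> c\<^sup>2 * (G - f)" using False by auto
    ultimately show ?thesis by linarith
  qed
  then show ?thesis using True assms by (simp add: excess_def divide_nonpos_pos)
next
  case False
  then have v: "G - f > 0" using assms by auto
  \<comment> \<open>Completing the square in \<open>c\<close>; equality holds for
    \<open>c = (G - F) / (G - f)\<close>.\<close>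
  have "0 \<le> (c * (G - f) - (G - F))\<^sup>2" by simp
  then have "(2 * c * (G - F) - c\<^sup>2 * (G - f)) * (G - f) \<le> (G - F)\<^sup>2"
    by (simp add: algebra_simps power2_eq_square)
  then have "2 * c * (G - F) - c\<^sup>2 * (G - f) \<le> (G - F)\<^sup>2 / (G - f)"
    using v by (simp add: pos_le_divide_eq)
  then have "(2 * c * (G - F) - c\<^sup>2 * (G - f)) / (G + f) \<le> (G - F)\<^sup>2 / (G - f) / (G + f)"
    using assms by (intro divide_right_mono) auto
  also have "\<dots> = excess G f F"
    using False by (simp add: excess_def square_diff_square_factored power2_eq_square[of G]
        power2_eq_square[of f] mult.commute)
  finally show ?thesis .
qed

text \<open>If the midpoint has positive excess, the \<open>c\<close> that is optimal there gives an
  affine function that equals \<open>excess\<close> at the midpoint and lies below it at both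
  endpoints. Otherwise nonnegativity is enough.\<close>

lemma excess_convex_aux:
  assumes dom: "\<bar>f1\<bar> \<le> F1" "\<bar>f2\<bar> \<le> F2" and u: "G1 + f1 = G2 + f2"
  shows "2 * excess ((G1 + G2) / 2) ((f1 + f2) / 2) ((F1 + F2) / 2) \<le> excess G1 f1 F1 + excess G2 f2 F2"
    (is "2 * excess ?G ?f ?F \<le> _")
proof (cases "?G \<le> ?F")
  case True
  then show ?thesis
    using excess_nonneg[OF dom(1), of G1] excess_nonneg[OF dom(2), of G2] by (simp add: excess_def)
next
  case False
  have ffF: "\<bar>?f\<bar> \<le> ?F" using dom by (auto simp: abs_le_iff field_simps)
  define u where "u = G1 + f1"
  have ueq: "G1 + f1 = u" "G2 + f2 = u" "?G + ?f = u"
    using u by (auto simp: u_def field_simps)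
  have "0 < y - x \<and> 0 < y + x" if "\<not> y \<le> z" "\<bar>x\<bar> \<le> z" for x y z :: real
    using that by linarith
  from this[OF False ffF] have u0: "u > 0" and v0: "?G - ?f > 0" unfolding ueq by auto
  define c where "c = (?G - ?F) / (?G - ?f)"
  have c: "0 \<le> c" "c \<le> 1" using False ffF v0 by (auto simp: c_def divide_le_eq_1)
  have "2 * excess ?G ?f ?F = 2 * ((2 * c * (?G - ?F) - c\<^sup>2 * (?G - ?f)) / u)"
  proof -
    have "2 * c * (?G - ?F) - c\<^sup>2 * (?G - ?f) = (?G - ?F)\<^sup>2 / (?G - ?f)"
      using v0 by (simp only: c_def) (simp add: power2_eq_square)
    moreover have "x\<^sup>2 - y\<^sup>2 = (x - y) * (x + y)" for x y :: real
      by (simp add: power2_eq_square algebra_simps)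
    from this[of ?G ?f] have "?G\<^sup>2 - ?f\<^sup>2 = (?G - ?f) * u" unfolding ueq .
    ultimately show ?thesis using False by (simp only: excess_def if_False divide_divide_eq_left)
  qed
  also have "\<dots> = (2 * c * (G1 - F1) - c\<^sup>2 * (G1 - f1)) / u + (2 * c * (G2 - F2) - c\<^sup>2 * (G2 - f2)) / u"
  proof -
    have "2 * (2 * c * (?G - ?F) - c\<^sup>2 * (?G - ?f)) =
        (2 * c * (G1 - F1) - c\<^sup>2 * (G1 - f1)) + (2 * c * (G2 - F2) - c\<^sup>2 * (G2 - f2))"
      by (simp add: add_divide_distrib algebra_simps)
    then show ?thesis
      by (simp only: add_divide_distrib[symmetric] times_divide_eq_right)
  qed
  also have "\<dots> \<le> excess G1 f1 F1 + excess G2 f2 F2"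
    using excess_ge_affine[OF dom(1), of G1 c] excess_ge_affine[OF dom(2), of G2 c] u0 c
    by (simp add: ueq)
  finally show ?thesis .
qed

text \<open>Equal absolute increments mean that either \<open>f - g\<close> or \<open>f + g\<close>
  is constant. The second case reduces to the first because \<open>excess\<close> is even in
  \<open>f\<close>.\<close>

lemma B_concave:
  assumes dom: "\<bar>f1\<bar> \<le> F1" "\<bar>f2\<bar> \<le> F2" and d: "\<bar>g1 - g2\<bar> = \<bar>f1 - f2\<bar>"
  shows "B g1 f1 F1 + B g2 f2 F2 \<le> 2 * B ((g1 + g2) / 2) ((f1 + f2) / 2) ((F1 + F2) / 2)"
proof -
  have neg: "- ((g1 + g2) / 2) = (- g1 + - g2) / 2" by (simp add: add_divide_distrib)
  consider "- g1 + f1 = - g2 + f2" | "- g1 + - f1 = - g2 + - f2" using d by linarith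
  then have "2 * excess (- ((g1 + g2) / 2)) ((f1 + f2) / 2) ((F1 + F2) / 2)
      \<le> excess (- g1) f1 F1 + excess (- g2) f2 F2"
  proof cases
    case 1
    then show ?thesis unfolding neg using dom by (intro excess_convex_aux)
  next
    case 2
    have m: "(f1 + f2) / 2 = - ((- f1 + - f2) / 2)" by (simp add: diff_divide_distrib add_divide_distrib)
    have "2 * excess ((- g1 + - g2) / 2) ((- f1 + - f2) / 2) ((F1 + F2) / 2)
      \<le> excess (- g1) (- f1) F1 + excess (- g2) (- f2) F2"
      using dom 2 by (intro excess_convex_aux) auto
    then show ?thesis unfolding neg m by (simp only: excess_uminus)
  qed
  then show ?thesis by (simp add: B_excess)
qed

lemma B_bounds:
  assumes "\<bar>f\<bar> \<le> F"
  shows "0 \<le> B g f F" "B g f F \<le> 1" "0 \<le> g \<Longrightarrow> B g f F = 1"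
proof -
  show "0 \<le> B g f F" "B g f F \<le> 1"
    using excess_nonneg[OF assms, of "- g"] excess_le_1[OF assms, of "- g"] by (auto simp: B_excess)
  show "B g f F = 1" if "0 \<le> g"
  proof -
    have "- g \<le> F" using that assms by linarith
    then show ?thesis by (simp add: B_def)
  qed
qed

section \<open>The value of finite dyadic trees\<close>

text \<open>A tree whose root has averages \<open>g\<close>, \<open>f\<close>, \<open>F\<close> of \<open>\<psi>\<close>, \<open>\<phi>\<close>, \<open>\<bar>\<phi>\<bar>\<close> and for which \<open>\<psi> \<ge> 0\<close> on a set
  of relative measure \<open>v\<close>; on a leaf both functions are constant.\<close>

inductive reach :: "real \<Rightarrow> real \<Rightarrow> real \<Rightarrow> real \<Rightarrow> bool" where
  leaf: "reach g f \<bar>f\<bar> (if 0 \<le> g then 1 else 0)"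
| node: "reach g1 f1 F1 v1 \<Longrightarrow> reach g2 f2 F2 v2 \<Longrightarrow> \<bar>g1 - g2\<bar> = \<bar>f1 - f2\<bar> \<Longrightarrow>
    reach ((g1 + g2) / 2) ((f1 + f2) / 2) ((F1 + F2) / 2) ((v1 + v2) / 2)"

definition V :: "real \<Rightarrow> real \<Rightarrow> real \<Rightarrow> real" where
  "V g f F = Sup {v. reach g f F v}"

lemma reach_bounds: "reach g f F v \<Longrightarrow> 0 \<le> v \<and> v \<le> 1"
  by (induction rule: reach.induct) auto

lemma bdd_reach: "bdd_above {v. reach g f F v}"
  using reach_bounds by (intro bdd_aboveI[of _ 1]) auto

text \<open>One split into leaves with values \<open>f - F\<close> and \<open>f + F\<close> of
  \<phi> suffices: by the hypothesis their absolute values average to \<open>F\<close>. This makes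
  the suprema range over nonempty sets.\<close>

lemma reach_exists:
  assumes "\<bar>f\<bar> \<le> F"
  obtains v where "reach g f F v" "F \<le> g \<Longrightarrow> v = 1"
proof -
  have "reach (((g - F) + (g + F)) / 2) (((f - F) + (f + F)) / 2) ((\<bar>f - F\<bar> + \<bar>f + F\<bar>) / 2)
     (((if 0 \<le> g - F then 1 else 0) + (if 0 \<le> g + F then 1 else 0)) / 2)"
    by (intro node leaf) simp
  moreover have "\<bar>f - F\<bar> + \<bar>f + F\<bar> = 2 * F" using assms by linarith
  ultimately have "reach g f F (((if 0 \<le> g - F then 1 else 0) + (if 0 \<le> g + F then 1 else 0)) / 2)"
    by simp
  from that[OF this] show ?thesis using assms by auto
qed

lemma V_upper: "reach g f F v \<Longrightarrow> v \<le> V g f F"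
  unfolding V_def using bdd_reach by (intro cSup_upper) auto

lemma V_least:
  assumes "\<bar>f\<bar> \<le> F" "\<And>v. reach g f F v \<Longrightarrow> v \<le> c"
  shows "V g f F \<le> c"
  unfolding V_def using reach_exists[OF assms(1), of g] assms(2) by (intro cSup_least) auto

lemma V_bounds:
  assumes "\<bar>f\<bar> \<le> F"
  shows "0 \<le> V g f F" "V g f F \<le> 1"
proof -
  obtain v where "reach g f F v" using reach_exists[OF assms] by blast
  then show "0 \<le> V g f F" using V_upper reach_bounds by (meson order_trans)
  show "V g f F \<le> 1" using assms reach_bounds by (intro V_least) auto
qed

section \<open>Concavity of \<open>V\<close> along admissible segments\<close>

lemma V_midpoint:
  assumes dom: "\<bar>f1\<bar> \<le> F1" "\<bar>f2\<bar> \<le> F2" and d: "\<bar>g1 - g2\<bar> = \<bar>f1 - f2\<bar>"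
  shows "(V g1 f1 F1 + V g2 f2 F2) / 2 \<le> V ((g1 + g2) / 2) ((f1 + f2) / 2) ((F1 + F2) / 2)"
    (is "_ \<le> ?W")
proof -
  \<comment> \<open>Two trees are joined under a new root; the suprema are taken one after the
    other, first with the second tree fixed.\<close>
  have "V g1 f1 F1 \<le> 2 * ?W - v2" if v2: "reach g2 f2 F2 v2" for v2
  proof (rule V_least[OF dom(1)])
    fix v1 assume "reach g1 f1 F1 v1"
    from V_upper[OF node[OF this v2 d]] show "v1 \<le> 2 * ?W - v2" by simp
  qed
  then have "V g2 f2 F2 \<le> 2 * ?W - V g1 f1 F1"
    by (intro V_least[OF dom(2)]) (smt (verit))
  then show ?thesis by simp
qed

text \<open>Midpoint concavity alone does not control \<open>h\<close> at non-dyadic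
  \<open>t\<close>; the lower bound \<open>0\<close> takes the place of continuity.\<close>

lemma midpoint_concave_imp_above_chord:
  fixes h :: "real \<Rightarrow> real"
  assumes mid: "\<And>s t. s \<in> {0..1} \<Longrightarrow> t \<in> {0..1} \<Longrightarrow> (h s + h t) / 2 \<le> h ((s + t) / 2)"
    and nonneg: "\<And>t. t \<in> {0..1} \<Longrightarrow> 0 \<le> h t"
    and t: "t \<in> {0..1}"
  shows "(1 - t) * h 0 + t * h 1 \<le> h t"
proof -
  \<comment> \<open>One step towards the nearer endpoint halves the possible deficit below the chord.\<close>
  define L where "L t = (1 - t) * h 0 + t * h 1" for t
  define K where "K = h 0 + h 1"
  have "- K / 2 ^ n \<le> h t - L t" for n
    using t
  proof (induction n arbitrary: t)
    case 0
    have "L t \<le> 1 * h 0 + 1 * h 1"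
      unfolding L_def using 0 nonneg[of 0] nonneg[of 1] by (intro add_mono mult_right_mono) auto
    then show ?case using nonneg[of t] 0 by (simp add: K_def)
  next
    case (Suc n)
    have half: "- K / 2 ^ Suc n = - K / 2 ^ n / 2" by simp
    show ?case
    proof (cases "t \<le> 1 / 2")
      case True
      have "L t = (h 0 + L (2 * t)) / 2" by (simp add: L_def field_simps)
      moreover have "(h 0 + h (2 * t)) / 2 \<le> h t" using mid[of 0 "2 * t"] Suc.prems True by simp
      moreover have "- K / 2 ^ n \<le> h (2 * t) - L (2 * t)" using Suc.prems True by (intro Suc.IH) auto
      ultimately show ?thesis unfolding half by argo
    next
      case False
      have "L t = (h 1 + L (2 * t - 1)) / 2" by (simp add: L_def field_simps)
      moreover have "(h 1 + h (2 * t - 1)) / 2 \<le> h t" using mid[of 1 "2 * t - 1"] Suc.prems False by simp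
      moreover have "- K / 2 ^ n \<le> h (2 * t - 1) - L (2 * t - 1)" using Suc.prems False by (intro Suc.IH) auto
      ultimately show ?thesis unfolding half by argo
    qed
  qed
  moreover have "(\<lambda>n. - K / 2 ^ n) \<longlonglongrightarrow> 0"
    by (rule LIMSEQ_divide_realpow_zero) simp
  ultimately have "0 \<le> h t - L t" by (intro LIMSEQ_le_const2[OF _ exI, of _ 0]) auto
  then show ?thesis by (simp add: L_def)
qed

text \<open>The domain is convex, so the whole segment stays in it, and any two of its points
  inherit the equality of increments from the endpoints. Thus \<open>V\<close> restricted to the
  segment is midpoint concave and nonnegative.\<close>

lemma V_segment:
  assumes dom: "\<bar>f1\<bar> \<le> F1" "\<bar>f2\<bar> \<le> F2" and d: "\<bar>g1 - g2\<bar> = \<bar>f1 - f2\<bar>"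
    and t: "0 \<le> t" "t \<le> 1"
    and eq: "g = (1 - t) * g1 + t * g2" "f = (1 - t) * f1 + t * f2" "F = (1 - t) * F1 + t * F2"
  shows "(1 - t) * V g1 f1 F1 + t * V g2 f2 F2 \<le> V g f F"
proof -
  define a where "a x y t = (1 - t) * x + t * y" for x y t :: real
  have a_mid: "a x y ((s + t) / 2) = (a x y s + a x y t) / 2" for x y s t
    by (simp add: a_def field_simps)
  have a_dom: "\<bar>a f1 f2 s\<bar> \<le> a F1 F2 s" if "s \<in> {0..1}" for s
  proof -
    have "\<bar>a f1 f2 s\<bar> \<le> \<bar>(1 - s) * f1\<bar> + \<bar>s * f2\<bar>" unfolding a_def by (rule abs_triangle_ineq)
    also have "\<dots> = (1 - s) * \<bar>f1\<bar> + s * \<bar>f2\<bar>" using that by (simp add: abs_mult)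
    also have "\<dots> \<le> a F1 F2 s" unfolding a_def using that dom by (intro add_mono mult_left_mono) auto
    finally show ?thesis .
  qed
  have a_d: "\<bar>a g1 g2 s - a g1 g2 t\<bar> = \<bar>a f1 f2 s - a f1 f2 t\<bar>" for s t
  proof -
    have "a x y s - a x y t = (t - s) * (x - y)" for x y by (simp add: a_def algebra_simps)
    then show ?thesis using d by (simp add: abs_mult)
  qed
  have "(1 - t) * V (a g1 g2 0) (a f1 f2 0) (a F1 F2 0) + t * V (a g1 g2 1) (a f1 f2 1) (a F1 F2 1)
      \<le> V (a g1 g2 t) (a f1 f2 t) (a F1 F2 t)"
  proof (rule midpoint_concave_imp_above_chord[where h = "\<lambda>t. V (a g1 g2 t) (a f1 f2 t) (a F1 F2 t)"])
    fix s t :: real assume "s \<in> {0..1}" "t \<in> {0..1}"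
    from V_midpoint[OF a_dom[OF this(1)] a_dom[OF this(2)] a_d]
    show "(V (a g1 g2 s) (a f1 f2 s) (a F1 F2 s) + V (a g1 g2 t) (a f1 f2 t) (a F1 F2 t)) / 2
        \<le> V (a g1 g2 ((s + t) / 2)) (a f1 f2 ((s + t) / 2)) (a F1 F2 ((s + t) / 2))"
      by (simp only: a_mid)
  qed (use t a_dom V_bounds(1) in auto)
  then show ?thesis by (simp add: a_def eq)
qed

section \<open>Explicit lower bounds for \<open>V\<close>, from the faces of the domain to its
  interior\<close>

lemma V_leaf: "0 \<le> g \<Longrightarrow> V g f \<bar>f\<bar> = 1"
  using V_upper[OF leaf[of g f]] V_bounds(2)[of f "\<bar>f\<bar>" g] by simp

lemma eq_1_if_ge_arbitrarily_close:
  fixes x :: real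
  assumes "\<And>t. 0 < t \<Longrightarrow> t < 1 \<Longrightarrow> 1 - t \<le> x" "x \<le> 1"
  shows "x = 1"
proof (rule antisym)
  show "1 \<le> x"
  proof (rule field_le_epsilon)
    fix e :: real assume "0 < e"
    then have "1 - min e (1 / 2) \<le> x" by (intro assms(1)) auto
    then show "1 \<le> x + e" by linarith
  qed
qed fact

text \<open>At the endpoint with \<open>g = 0\<close> a single leaf gives the value
  \<open>1\<close>; at the other endpoint only \<open>V \<ge> 0\<close> is known, but its weight
  tends to \<open>0\<close> as it recedes to infinity.\<close>

lemma V_boundary:
  assumes "0 \<le> b" "- g \<le> b"
  shows "V g b b = 1"
proof (cases "0 \<le> g")
  case True
  then show ?thesis using V_leaf[of g b] assms by simp
next
  case False
  show ?thesis
  proof (rule eq_1_if_ge_arbitrarily_close)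
    fix t :: real assume t: "0 < t" "t < 1"
    \<comment> \<open>The segment runs from \<open>g = 0\<close> to a far point of the ray \<open>g + f = const\<close>, \<open>F = f\<close>.\<close>
    define s where "s = g / t"
    have s: "t * s = g" "s < 0" using t False by (simp_all add: s_def divide_neg_pos)
    have "(1 - t) * V 0 (b + g) (b + g) + t * V s (b + g - s) (b + g - s) \<le> V g b b"
      by (rule V_segment) (use s t assms in \<open>simp_all add: algebra_simps\<close>)
    moreover have "V 0 (b + g) (b + g) = 1" using V_leaf[of 0 "b + g"] assms by simp
    moreover have "0 \<le> t * V s (b + g - s) (b + g - s)"
      using s t assms by (intro mult_nonneg_nonneg V_bounds) auto
    ultimately show "1 - t \<le> V g b b" by simp
  qed (use assms in \<open>auto intro: V_bounds\<close>)
qed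

text \<open>The segment keeps \<open>g - f\<close> constant and joins the face \<open>F = f\<close>,
  where the value \<open>1\<close> is already known, to the face \<open>F = - f\<close>. The
  endpoints come from solving \<open>(1 - t) * b = (F + f) / 2\<close> and
  \<open>t * a = (F - f) / 2\<close>.\<close>

lemma V_eq_1:
  assumes dom: "\<bar>f\<bar> \<le> F" and g: "- g \<le> F"
  shows "V g f F = 1"
proof (rule eq_1_if_ge_arbitrarily_close)
  fix t :: real assume t: "0 < t" "t < 1"
  \<comment> \<open>The weight \<open>t\<close> of the endpoint on the face \<open>F = - f\<close> is small, so only the other counts.\<close>
  define a where "a = (F - f) / 2 / t"
  define b where "b = (F + f) / 2 / (1 - t)"
  have a0: "0 \<le> a" and b0: "(F + f) / 2 \<le> b"
  proof -
    show "0 \<le> a" unfolding a_def using dom t by auto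
    have "(F + f) / 2 * (1 - t) \<le> (F + f) / 2" using dom t by (intro mult_left_le) auto
    then show "(F + f) / 2 \<le> b" unfolding b_def using t by (subst pos_le_divide_eq) auto
  qed
  have b0': "0 \<le> b" using dom t by (auto simp: b_def)
  have "(1 - t) * V (g - f + b) b b + t * V (g - f - a) (- a) a \<le> V g f F"
  proof (rule V_segment)
    have "x * (y / x) = y" if "0 < x" for x y :: real using that by simp
    then have ab: "(1 - t) * b = (F + f) / 2" "t * a = (F - f) / 2"
      unfolding a_def b_def using t by (simp_all only: diff_gt_0_iff_gt)
    show "g = (1 - t) * (g - f + b) + t * (g - f - a)"
      using ab by (simp add: algebra_simps)
    show "f = (1 - t) * b + t * - a" "F = (1 - t) * b + t * a"
      using ab by (simp_all add: field_simps)
  qed (use t a0 b0' in auto)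
  \<comment> \<open>The condition \<open>- (g - f + b) \<le> b\<close> says
    \<open>f - g \<le> 2 * b\<close>, which follows from \<open>- g \<le> F\<close> and
    \<open>F + f \<le> 2 * b\<close>.\<close>
  moreover have "V (g - f + b) b b = 1"
    using b0 b0' g by (intro V_boundary) auto
  moreover have "0 \<le> t * V (g - f - a) (- a) a"
    using a0 t by (intro mult_nonneg_nonneg V_bounds) auto
  ultimately show "1 - t \<le> V g f F" by simp
qed (use dom in \<open>rule V_bounds\<close>)

text \<open>The left side is the value of \<open>B\<close> on the face \<open>F = - f\<close>. The
  segment keeps \<open>G + b\<close> equal to \<open>2 * w\<close>; it runs from
  \<open>G = 2 * w\<close>, \<open>b = 0\<close>, where \<open>V \<ge> 0\<close>, to
  \<open>G = b = w\<close>, where \<open>V = 1\<close>.\<close>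

lemma V_face:
  assumes "0 \<le> b" "b \<le> G" "0 < G + b"
  shows "2 * b / (G + b) \<le> V (- G) (- b) b"
proof -
  define w where "w = (G + b) / 2"
  have w: "0 < w" "G = 2 * w - b" using assms by (simp_all add: w_def add_divide_distrib)
  define t where "t = b / w"
  have t: "0 \<le> t" "t \<le> 1" and tw: "t * w = b" using assms w by (auto simp: t_def divide_le_eq_1)
  have "(1 - t) * V (- (2 * w)) 0 0 + t * V (- w) (- w) w \<le> V (- G) (- b) b"
    by (rule V_segment) (use t tw w in \<open>auto simp: algebra_simps\<close>)
  moreover have "V (- w) (- w) w = 1"
    using w by (intro V_eq_1) auto
  moreover have "0 \<le> (1 - t) * V (- (2 * w)) 0 0"
    using t by (intro mult_nonneg_nonneg V_bounds) auto
  ultimately have "t \<le> V (- G) (- b) b" by simp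
  then show ?thesis by (simp add: t_def w_def mult.commute)
qed

text \<open>The segment below is the one along which \<open>B\<close> is affine: it joins the
  curve \<open>G = f = F\<close> to the face \<open>F = - f\<close>.\<close>

lemma B_le_V:
  assumes dom: "\<bar>f\<bar> \<le> F"
  shows "B g f F \<le> V g f F"
proof (cases "- g \<le> F")
  case True
  then show ?thesis using V_eq_1[OF dom] B_bounds(2)[OF dom] by simp
next
  case False
  define G where "G = - g"
  \<comment> \<open>The endpoints are \<open>G = f = F = p\<close> and \<open>G = p + q\<close>,
    \<open>F = - f = q - p\<close>; \<mu> is the weight of the second. The deficit of
    \<open>B\<close> is \<open>0\<close> at the first and \<open>c = p / q\<close> at the second, so
    \<open>\<mu> * c\<close> is the deficit at the given point.\<close>
  define p where "p = (G + f) / 2"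
  define q where "q = (G + f) / 2 * ((G - f) / (G - F))"
  define \<mu> where "\<mu> = (G - F) / (G + f)"
  define c where "c = (G - F) / (G - f)"
  have pos: "0 < G - F" "0 < G + f" "0 < G - f" using False dom by (auto simp: G_def)
  have \<mu>: "0 \<le> \<mu>" "\<mu> \<le> 1" using pos dom by (auto simp: \<mu>_def divide_le_eq_1)
  have \<mu>q: "2 * (\<mu> * q) = G - f" and \<mu>p: "2 * (\<mu> * p) = G - F" and pq: "p / q = c"
  proof -
    have "2 * (x / y * (y / 2 * (z / x))) = z" "2 * (x / y * (y / 2)) = x"
      "y / 2 / (y / 2 * (z / x)) = x / z" if "0 < x" "0 < y" "0 < z" for x y z :: real
      using that by simp_all
    from this[OF pos] show "2 * (\<mu> * q) = G - f" "2 * (\<mu> * p) = G - F" "p / q = c"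
      unfolding \<mu>_def q_def p_def c_def by blast+
  qed
  have eq: "G + f = 2 * p" "G = - g" by (auto simp: p_def G_def)
  have "G - F \<le> G - f" using dom by linarith
  then have "1 \<le> (G - f) / (G - F)" using pos by (subst pos_le_divide_eq) auto
  then have "p * 1 \<le> q" unfolding p_def q_def using pos by (intro mult_left_mono) auto
  then have "p \<le> q" by simp
  have p: "0 < p" using pos by (simp add: p_def)
  have "(1 - \<mu>) * V (- p) p p + \<mu> * V (- (p + q)) (- (q - p)) (q - p) \<le> V g f F"
  proof (rule V_segment)
    have "(1 - \<mu>) * - p + \<mu> * - (p + q) = - p - \<mu> * q" by (simp add: algebra_simps)
    then show "g = (1 - \<mu>) * - p + \<mu> * - (p + q)" using eq \<mu>q by simp
    have "(1 - \<mu>) * p + \<mu> * - (q - p) = p - \<mu> * q" by (simp add: algebra_simps)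
    then show "f = (1 - \<mu>) * p + \<mu> * - (q - p)" using eq \<mu>q by simp
    have "(1 - \<mu>) * p + \<mu> * (q - p) = p + \<mu> * q - 2 * (\<mu> * p)" by (simp add: algebra_simps)
    then show "F = (1 - \<mu>) * p + \<mu> * (q - p)" using eq(1) \<mu>q \<mu>p by linarith
  qed (use \<mu> p \<open>p \<le> q\<close> in auto)
  moreover have "V (- p) p p = 1"
    using p by (intro V_boundary) auto
  moreover have "1 - c \<le> V (- (p + q)) (- (q - p)) (q - p)"
  proof -
    have "1 - c = 2 * (q - p) / (p + q + (q - p))"
      using p \<open>p \<le> q\<close> by (simp flip: pq add: diff_divide_distrib)
    then show ?thesis using V_face[of "q - p" "p + q"] p \<open>p \<le> q\<close> by simp
  qed
  then have "\<mu> * (1 - c) \<le> \<mu> * V (- (p + q)) (- (q - p)) (q - p)"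
    using \<mu> by (intro mult_left_mono)
  ultimately have "(1 - \<mu>) + \<mu> * (1 - c) \<le> V g f F" by simp
  moreover have "\<mu> * c = (g + F)\<^sup>2 / (g\<^sup>2 - f\<^sup>2)"
  proof -
    have "\<mu> * c = (G - F)\<^sup>2 / (G\<^sup>2 - f\<^sup>2)"
      by (simp add: \<mu>_def c_def power2_eq_square square_diff_square_factored)
    moreover have "(G - F)\<^sup>2 = (g + F)\<^sup>2" "G\<^sup>2 = g\<^sup>2"
      by (simp_all add: G_def power2_eq_square algebra_simps)
    ultimately show ?thesis by simp
  qed
  ultimately show ?thesis using False by (simp add: B_def algebra_simps)
qed

section \<open>The upper bound\<close>

lemma sum_pairs: "(\<Sum>i<2 * N. h i) = (\<Sum>k<N. h (2 * k) + h (2 * k + 1))" for h :: "nat \<Rightarrow> real"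
  by (induction N) (simp_all add: add.assoc)

lemma sum_split: "(\<Sum>k<M + N. h k) = (\<Sum>k<M. h k) + (\<Sum>k<N. h (M + k))" for h :: "nat \<Rightarrow> real"
  by (induction N) (simp_all add: add.assoc)

lemma abs_mean_le: "\<bar>mean \<phi> n k\<bar> \<le> mean (\<lambda>x. \<bar>\<phi> x\<bar>) n k"
proof -
  have "\<bar>LINT x:dint n k|lebesgue. \<phi> x\<bar> \<le> (LINT x:dint n k|lebesgue. \<bar>\<phi> x\<bar>)"
    unfolding set_lebesgue_integral_def
    by (rule order_trans[OF integral_abs_bound]) (simp add: abs_mult)
  then show ?thesis by (simp add: mean_def abs_mult)
qed

lemma mean_const:
  assumes "\<And>x. x \<in> dint n k \<Longrightarrow> \<phi> x = c"
  shows "mean \<phi> n k = c"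
proof -
  have "(LINT x:dint n k|lebesgue. \<phi> x) = (LINT x:dint n k|lebesgue. c)"
    using assms by (intro set_lebesgue_integral_cong) auto
  also have "\<dots> = len (dint n k) * c"
    by (simp add: set_lebesgue_integral_def)
  finally show ?thesis by (simp add: mean_def len_dint)
qed

lemma avg_eq_sum_mean:
  assumes "set_integrable lebesgue I0 \<phi>"
  shows "(\<Sum>k<2 ^ n. mean \<phi> n k) = 2 ^ n * avg I0 \<phi>"
proof (induction n)
  case (Suc n)
  have "(\<Sum>k<2 ^ Suc n. mean \<phi> (Suc n) k) = (\<Sum>k<2 ^ n. 2 * mean \<phi> n k)"
    unfolding power_Suc sum_pairs
  proof (intro sum.cong refl)
    fix k :: nat assume "k \<in> {..<2 ^ n}"
    then show "mean \<phi> (Suc n) (2 * k) + mean \<phi> (Suc n) (2 * k + 1) = 2 * mean \<phi> n k"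
      using mean_halves[OF assms, of k n] by simp
  qed
  then show ?case using Suc by (simp flip: sum_distrib_left)
qed (simp add: avg_I0)

text \<open>The values of \<open>m\<close> on two siblings are \<open>m n k - d n k\<close> and
  \<open>m n k + d n k\<close>, so they differ as much as the means of \<phi> do. Then
  \<open>B_concave\<close> bounds the sum over the siblings by twice the value at their
  parent.\<close>

lemma sum_B_decreasing:
  assumes int: "set_integrable lebesgue I0 \<phi>"
    and step: "\<And>n k. k < 2 ^ Suc n \<Longrightarrow> m (Suc n) k - m n (k div 2) =
      (if odd k then 1 else - 1) * d n (k div 2)"
    and d: "\<And>n k. k < 2 ^ n \<Longrightarrow>
      \<bar>d n k\<bar> = \<bar>mean \<phi> (Suc n) (2 * k + 1) - mean \<phi> (Suc n) (2 * k)\<bar> / 2"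
  defines "b \<equiv> \<lambda>n k. B (m n k) (mean \<phi> n k) (mean (\<lambda>x. \<bar>\<phi> x\<bar>) n k)"
  shows "(\<Sum>k<2 ^ n. b n k) \<le> 2 ^ n * b 0 0"
proof (induction n)
  case (Suc n)
  have "b (Suc n) (2 * k) + b (Suc n) (2 * k + 1) \<le> 2 * b n k" if k: "k < 2 ^ n" for k
  proof -
    have m: "m (Suc n) (2 * k) = m n k - d n k" "m (Suc n) (2 * k + 1) = m n k + d n k"
      using step[of "2 * k" n] step[of "2 * k + 1" n] k by auto
    have "\<bar>m (Suc n) (2 * k) - m (Suc n) (2 * k + 1)\<bar>
        = \<bar>mean \<phi> (Suc n) (2 * k) - mean \<phi> (Suc n) (2 * k + 1)\<bar>"
    proof -
      have "m (Suc n) (2 * k) - m (Suc n) (2 * k + 1) = - (2 * d n k)" unfolding m by simp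
      then show ?thesis using d[OF k] by (simp add: abs_mult abs_minus_commute)
    qed
    moreover have "(m (Suc n) (2 * k) + m (Suc n) (2 * k + 1)) / 2 = m n k" unfolding m by simp
    ultimately show ?thesis
      using B_concave[OF abs_mean_le abs_mean_le]
      unfolding b_def mean_halves[OF int k] mean_halves[OF set_integrable_abs[OF int] k] by metis
  qed
  then have "(\<Sum>k<2 ^ Suc n. b (Suc n) k) \<le> (\<Sum>k<2 ^ n. 2 * b n k)"
    unfolding power_Suc sum_pairs by (intro sum_mono) auto
  then show ?case using Suc by (simp flip: sum_distrib_left)
qed simp

text \<open>Cell values of the partial sums, built from the coefficients directly, without
  identifying them with means of \<psi>. Generation \<open>Suc n\<close> corresponds to the sum over
  \<open>dyadic_upto n\<close>.\<close>

primrec mart :: "(real set \<Rightarrow> real) \<Rightarrow> real \<Rightarrow> nat \<Rightarrow> nat \<Rightarrow> real" where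
  "mart c g 0 k = g"
| "mart c g (Suc n) k =
     mart c g n (k div 2) + (if odd k then 1 else - 1) * c (dint n (k div 2)) * sqrt (2 ^ n)"

lemma nonneg_set_measurable:
  fixes \<psi> :: "real \<Rightarrow> real"
  assumes "set_integrable lebesgue I0 \<psi>"
  shows "{x \<in> I0. 0 \<le> \<psi> x} \<in> sets lebesgue"
proof -
  have "(\<lambda>x. indicator I0 x *\<^sub>R \<psi> x) \<in> borel_measurable lebesgue"
    using assms by (simp add: set_integrable_def borel_measurable_integrable)
  from borel_measurable_le[OF borel_measurable_const this]
  have "{x \<in> space lebesgue. 0 \<le> indicator I0 x *\<^sub>R \<psi> x} \<in> sets lebesgue" .
  then have "I0 \<inter> {x. 0 \<le> indicator I0 x *\<^sub>R \<psi> x} \<in> sets lebesgue"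
    by (intro sets.Int) auto
  also have "I0 \<inter> {x. 0 \<le> indicator I0 x *\<^sub>R \<psi> x} = {x \<in> I0. 0 \<le> \<psi> x}"
    by auto
  finally show ?thesis .
qed

text \<open>Where \<psi> vanishes, every partial sum may be negative. Raised by \<delta>, the
  partial sums are nonnegative from some generation on, almost everywhere on the level set.\<close>

lemma level_set_bound:
  assumes mt: "martingale_transform \<phi> \<psi>" and "0 < \<delta>"
  shows "len {x \<in> I0. 0 \<le> \<psi> x} \<le> B (avg I0 \<psi> + \<delta>) (avg I0 \<phi>) (avg I0 (\<lambda>x. \<bar>\<phi> x\<bar>))"
    (is "len ?A \<le> ?b")
proof -
  obtain \<epsilon> :: "real set \<Rightarrow> real" where
    int: "set_integrable lebesgue I0 \<phi>" "set_integrable lebesgue I0 \<psi>" and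
    \<epsilon>: "\<And>I. I \<in> dyadic \<Longrightarrow> I \<subseteq> I0 \<Longrightarrow> \<epsilon> I \<in> {- 1, 1}" and
    lim: "AE x\<in>I0 in lebesgue.
       (\<lambda>n. avg I0 \<psi> + (\<Sum>I\<in>dyadic_upto n. \<epsilon> I * haar_coeff \<phi> I * haar I x)) \<longlonglongrightarrow> \<psi> x"
    using mt unfolding martingale_transform_def by blast
  define c where "c I = \<epsilon> I * haar_coeff \<phi> I" for I
  define m where "m = mart c (avg I0 \<psi> + \<delta>)"
  have m_sum: "avg I0 \<psi> + (\<Sum>I\<in>dyadic_upto n. \<epsilon> I * haar_coeff \<phi> I * haar I x) = m (Suc n) k - \<delta>"
    if "k < 2 ^ Suc n" "x \<in> dint (Suc n) k" for n k x
    using haar_sum[of m c, OF _ that] by (simp add: m_def c_def)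
  have sum_le: "(\<Sum>k<2 ^ n. B (m n k) (mean \<phi> n k) (mean (\<lambda>x. \<bar>\<phi> x\<bar>) n k)) \<le> 2 ^ n * ?b" for n
  proof -
    have "\<bar>c (dint n k) * sqrt (2 ^ n)\<bar> =
        \<bar>mean \<phi> (Suc n) (2 * k + 1) - mean \<phi> (Suc n) (2 * k)\<bar> / 2" if k: "k < 2 ^ n" for n k
    proof -
      have "\<bar>\<epsilon> (dint n k)\<bar> = 1"
        using \<epsilon>[OF dint_in_dyadic dint_subset_I0[OF k]] by auto
      then have "\<bar>c (dint n k) * sqrt (2 ^ n)\<bar> = \<bar>haar_coeff \<phi> (dint n k) * sqrt (2 ^ n)\<bar>"
        by (simp add: c_def abs_mult)
      then show ?thesis using haar_coeff_dint[OF int(1) k] by simp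
    qed
    from sum_B_decreasing[OF int(1) _ this, of m n] show ?thesis
      by (simp add: m_def avg_I0 mult.assoc)
  qed
  define E where "E n = (\<Union>k\<in>{k. k < 2 ^ Suc n \<and> 0 \<le> m (Suc n) k}. dint (Suc n) k)" for n
  have E_sets: "E n \<in> sets lebesgue" for n
    unfolding E_def by (intro sets.finite_UN) auto
  have E_fin: "E n \<in> lmeasurable" for n
  proof (rule fmeasurableI2)
    show "E n \<subseteq> I0" unfolding E_def using dint_subset_I0 by blast
  qed (use E_sets in auto)
  have E_len: "len (E n) \<le> ?b" for n
  proof -
    let ?K = "{k. k < 2 ^ Suc n \<and> 0 \<le> m (Suc n) k}"
    have "len (E n) \<le> (\<Sum>k\<in>?K. len (dint (Suc n) k))"
      unfolding E_def by (intro measure_UNION_le) auto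
    also have "\<dots> = (\<Sum>k\<in>?K. 1) / 2 ^ Suc n"
      by (simp add: len_dint)
    \<comment> \<open>On the cells counted by \<open>?K\<close> the summand is \<open>1\<close>,
      since \<open>B = 1\<close> for nonnegative first argument; on the others it is
      nonnegative.\<close>
    also have "(\<Sum>k\<in>?K. 1) \<le>
        (\<Sum>k<2 ^ Suc n. B (m (Suc n) k) (mean \<phi> (Suc n) k) (mean (\<lambda>x. \<bar>\<phi> x\<bar>) (Suc n) k))"
      using B_bounds[OF abs_mean_le] by (intro sum_le_included[where i = id]) auto
    also have "\<dots> \<le> 2 ^ Suc n * ?b" by (rule sum_le)
    finally show ?thesis by (simp add: divide_right_mono)
  qed
  have A_sets: "?A \<in> sets lebesgue" using nonneg_set_measurable[OF int(2)] .
  \<comment> \<open>Almost every point of \<open>?A\<close> lies in \<open>E n\<close> for all large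
    \<open>n\<close>, so the bound on \<open>E n\<close> passes to \<open>?A\<close> by dominated
    convergence.\<close>
  have "(\<lambda>n. LINT x|lebesgue. indicat_real (?A \<inter> E n) x) \<longlonglongrightarrow> (LINT x|lebesgue. indicat_real ?A x)"
  proof (rule integral_dominated_convergence[where w = "indicat_real I0"])
    show "AE x in lebesgue. (\<lambda>n. indicat_real (?A \<inter> E n) x) \<longlonglongrightarrow> indicat_real ?A x"
      using lim AE_I0
    proof eventually_elim
      case (elim x)
      show ?case
      proof (cases "x \<in> ?A")
        case True
        then have x01: "x \<in> {0..<1}" and conv: "(\<lambda>n. avg I0 \<psi> +
            (\<Sum>I\<in>dyadic_upto n. \<epsilon> I * haar_coeff \<phi> I * haar I x)) \<longlonglongrightarrow> \<psi> x"
          using elim by auto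
        have "eventually (\<lambda>n. - \<delta> < avg I0 \<psi> +
            (\<Sum>I\<in>dyadic_upto n. \<epsilon> I * haar_coeff \<phi> I * haar I x)) sequentially"
          using True \<open>0 < \<delta>\<close> by (intro order_tendstoD(1)[OF conv]) auto
        then have "eventually (\<lambda>n. indicat_real (?A \<inter> E n) x = indicat_real ?A x) sequentially"
        proof eventually_elim
          case (elim n)
          obtain k where k: "k < 2 ^ Suc n" "x \<in> dint (Suc n) k"
            using x01 union_dint[of "Suc n"] by blast
          then have "x \<in> E n" using elim m_sum[OF k] by (auto simp: E_def)
          then show ?case by (simp add: indicator_def)
        qed
        then show ?thesis by (rule tendsto_eventually)
      next
        case False
        then have "indicat_real (?A \<inter> E n) x = indicat_real ?A x" for n
          by (auto simp: indicator_def)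
        then show ?thesis by simp
      qed
    qed
    show "integrable lebesgue (indicat_real I0)"
      by (simp flip: lmeasurable_iff_integrable)
    show "indicat_real ?A \<in> borel_measurable lebesgue"
      by (rule borel_measurable_indicator[OF A_sets])
    show "indicat_real (?A \<inter> E n) \<in> borel_measurable lebesgue" for n
      by (rule borel_measurable_indicator[OF sets.Int[OF A_sets E_sets]])
    show "AE x in lebesgue. norm (indicat_real (?A \<inter> E n) x) \<le> indicat_real I0 x" for n
      by (intro AE_I2) (auto simp: indicator_def)
  qed
  then have "(\<lambda>n. len (?A \<inter> E n)) \<longlonglongrightarrow> len ?A" by simp
  moreover have "len (?A \<inter> E n) \<le> ?b" for n
  proof -
    have "len (?A \<inter> E n) \<le> len (E n)"
      using A_sets E_sets E_fin by (intro measure_mono_fmeasurable) auto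
    then show ?thesis using E_len[of n] by simp
  qed
  ultimately show ?thesis by (intro LIMSEQ_le_const2[OF _ exI, of _ "len ?A"]) auto
qed

lemma level_set_le_B:
  assumes mt: "martingale_transform \<phi> \<psi>"
    and avgs: "avg I0 \<psi> = g" "avg I0 \<phi> = f" "avg I0 (\<lambda>x. \<bar>\<phi> x\<bar>) = F"
    and dom: "\<bar>f\<bar> \<le> F"
  shows "len {x \<in> I0. 0 \<le> \<psi> x} \<le> B g f F"
proof -
  have bound: "len {x \<in> I0. 0 \<le> \<psi> x} \<le> B (g + \<delta>) f F" if "0 < \<delta>" for \<delta>
    using level_set_bound[OF mt that] avgs by simp
  show ?thesis
  proof (cases "- g \<le> F")
    case True
    then show ?thesis using bound[of 1] B_bounds(2)[OF dom, of "g + 1"] by (simp add: B_def)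
  next
    case False
    have "\<bar>f\<bar> < \<bar>g\<bar>" using False dom by linarith
    then have "g\<^sup>2 - f\<^sup>2 \<noteq> 0" by (simp add: power2_eq_iff) linarith
    then have "((\<lambda>\<delta>. 1 - (g + \<delta> + F)\<^sup>2 / ((g + \<delta>)\<^sup>2 - f\<^sup>2)) \<longlongrightarrow>
        1 - (g + 0 + F)\<^sup>2 / ((g + 0)\<^sup>2 - f\<^sup>2)) (at_right 0)"
      by (intro tendsto_intros) auto
    \<comment> \<open>For such \<delta> still \<open>- (g + \<delta>) > F\<close>, so
      \<open>B\<close> is given by its second branch, which is continuous at \<delta> = 0.\<close>
    moreover have "eventually (\<lambda>\<delta>. \<delta> < - g - F) (at_right 0)"
      using False by (intro eventually_at_right_real[THEN eventually_mono, of 0 "- g - F"]) auto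
    then have "eventually (\<lambda>\<delta>. len {x \<in> I0. 0 \<le> \<psi> x} \<le> 1 - (g + \<delta> + F)\<^sup>2 / ((g + \<delta>)\<^sup>2 - f\<^sup>2)) (at_right 0)"
      using eventually_at_right_less
    proof eventually_elim
      case (elim \<delta>)
      then show ?case using bound[of \<delta>] by (simp add: B_def)
    qed
    ultimately have "len {x \<in> I0. 0 \<le> \<psi> x} \<le> 1 - (g + 0 + F)\<^sup>2 / ((g + 0)\<^sup>2 - f\<^sup>2)"
      by (rule tendsto_lowerbound) simp
    then show ?thesis using False by (simp add: B_def)
  qed
qed

section \<open>Simple functions realizing a tree\<close>

text \<open>Here \<open>p n k\<close> and \<open>q n k\<close> are the means of \<open>\<phi>\<close> and \<open>\<psi>\<close> over \<open>dint n k\<close>; from generation \<open>N\<close> on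
  both functions are constant on the cells. Only indices \<open>k < 2 ^ n\<close> are meaningful.\<close>

definition realizes ::
    "(nat \<Rightarrow> nat \<Rightarrow> real) \<Rightarrow> (nat \<Rightarrow> nat \<Rightarrow> real) \<Rightarrow> nat \<Rightarrow> real \<Rightarrow> real \<Rightarrow> real \<Rightarrow> real \<Rightarrow> bool" where
  "realizes p q N g f F v \<longleftrightarrow> p 0 0 = f \<and> q 0 0 = g \<and>
     (\<forall>n k. k < 2 ^ n \<longrightarrow>
        p n k = (p (Suc n) (2 * k) + p (Suc n) (2 * k + 1)) / 2 \<and>
        q n k = (q (Suc n) (2 * k) + q (Suc n) (2 * k + 1)) / 2 \<and>
        \<bar>q (Suc n) (2 * k + 1) - q (Suc n) (2 * k)\<bar> = \<bar>p (Suc n) (2 * k + 1) - p (Suc n) (2 * k)\<bar>) \<and>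
     (\<forall>n k. N \<le> n \<longrightarrow> k < 2 ^ Suc n \<longrightarrow>
        p (Suc n) k = p n (k div 2) \<and> q (Suc n) k = q n (k div 2)) \<and>
     (\<forall>n\<ge>N. (\<Sum>k<2 ^ n. \<bar>p n k\<bar>) = 2 ^ n * F \<and> (\<Sum>k<2 ^ n. if 0 \<le> q n k then 1 else 0) = 2 ^ n * v)"

text \<open>Both trees move one generation down: \<open>p\<close> onto the left half of the unit
  interval, \<open>p'\<close> onto the right half.\<close>

fun glue :: "(nat \<Rightarrow> nat \<Rightarrow> real) \<Rightarrow> (nat \<Rightarrow> nat \<Rightarrow> real) \<Rightarrow> nat \<Rightarrow> nat \<Rightarrow> real" where
  "glue p p' 0 k = (p 0 0 + p' 0 0) / 2"
| "glue p p' (Suc n) k = (if k < 2 ^ n then p n k else p' n (k - 2 ^ n))"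

lemma glue_children:
  "k < 2 ^ n \<Longrightarrow> glue p p' (Suc (Suc n)) (2 * k) = p (Suc n) (2 * k)"
  "k < 2 ^ n \<Longrightarrow> glue p p' (Suc (Suc n)) (2 * k + 1) = p (Suc n) (2 * k + 1)"
  "\<not> k < 2 ^ n \<Longrightarrow> glue p p' (Suc (Suc n)) (2 * k) = p' (Suc n) (2 * (k - 2 ^ n))"
  "\<not> k < 2 ^ n \<Longrightarrow> glue p p' (Suc (Suc n)) (2 * k + 1) = p' (Suc n) (2 * (k - 2 ^ n) + 1)"
proof -
  show "k < 2 ^ n \<Longrightarrow> glue p p' (Suc (Suc n)) (2 * k) = p (Suc n) (2 * k)" by simp
  assume "k < 2 ^ n"
  then have "2 * k + 1 < 2 ^ Suc n" by simp
  then show "glue p p' (Suc (Suc n)) (2 * k + 1) = p (Suc n) (2 * k + 1)" by simp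
next
  assume "\<not> k < 2 ^ n"
  then have "\<not> 2 * k < 2 ^ Suc n" "\<not> 2 * k + 1 < 2 ^ Suc n"
    "2 * k - 2 ^ Suc n = 2 * (k - 2 ^ n)" "2 * k + 1 - 2 ^ Suc n = 2 * (k - 2 ^ n) + 1" by auto
  then show "glue p p' (Suc (Suc n)) (2 * k) = p' (Suc n) (2 * (k - 2 ^ n))"
    "glue p p' (Suc (Suc n)) (2 * k + 1) = p' (Suc n) (2 * (k - 2 ^ n) + 1)"
    by (simp_all only: glue.simps if_False)
qed

lemma sum_glue:
  "(\<Sum>k<2 ^ Suc n. h (glue p p' (Suc n) k)) = (\<Sum>k<2 ^ n. h (p n k)) + (\<Sum>k<2 ^ n. h (p' n k))"
  for h :: "real \<Rightarrow> real"
  unfolding power_Suc mult_2 sum_split by simp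

text \<open>Trees of different depths fit together because \<open>realizes\<close> gives the leaf
  sums at every generation from \<open>N\<close> on, so both are available from
  \<open>max N N'\<close> on. The hypothesis on increments is used at the new root; every other node
  lies inside one of the two trees.\<close>

lemma realizes_glue:
  assumes r: "realizes p q N g f F v" and r': "realizes p' q' N' g' f' F' v'"
    and d: "\<bar>g - g'\<bar> = \<bar>f - f'\<bar>"
  shows "realizes (glue p p') (glue q q') (Suc (max N N'))
    ((g + g') / 2) ((f + f') / 2) ((F + F') / 2) ((v + v') / 2)"
proof -
  note R = r[unfolded realizes_def] and R' = r'[unfolded realizes_def]
  let ?p = "glue p p'" and ?q = "glue q q'"
  have "?p n k = (?p (Suc n) (2 * k) + ?p (Suc n) (2 * k + 1)) / 2 \<and>
        ?q n k = (?q (Suc n) (2 * k) + ?q (Suc n) (2 * k + 1)) / 2 \<and>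
        \<bar>?q (Suc n) (2 * k + 1) - ?q (Suc n) (2 * k)\<bar> = \<bar>?p (Suc n) (2 * k + 1) - ?p (Suc n) (2 * k)\<bar>"
    if k: "k < 2 ^ n" for n k
  proof (cases n)
    case 0
    then show ?thesis using k R R' d by (simp add: abs_minus_commute)
  next
    case (Suc m)
    show ?thesis
    proof (cases "k < 2 ^ m")
      case True
      then have "?p n k = p m k" "?q n k = q m k" by (simp_all add: Suc)
      then show ?thesis using R True unfolding Suc by (simp only: glue_children)
    next
      case False
      then have "k - 2 ^ m < 2 ^ m" using k Suc by simp
      moreover have "?p n k = p' m (k - 2 ^ m)" "?q n k = q' m (k - 2 ^ m)"
        using False by (simp_all add: Suc)
      ultimately show ?thesis using R' False unfolding Suc by (simp only: glue_children not_False_eq_True)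
    qed
  qed
  moreover have "?p (Suc n) k = ?p n (k div 2) \<and> ?q (Suc n) k = ?q n (k div 2)"
    if n: "Suc (max N N') \<le> n" and k: "k < 2 ^ Suc n" for n k
  proof -
    obtain m where m: "n = Suc m" "N \<le> m" "N' \<le> m" using n by (cases n) auto
    show ?thesis
    proof (cases "k < 2 ^ Suc m")
      case True
      then have "k div 2 < 2 ^ m" by auto
      then show ?thesis using R m True by simp
    next
      case False
      then have "\<not> k div 2 < 2 ^ m" "(k - 2 ^ Suc m) div 2 = k div 2 - 2 ^ m" "k - 2 ^ Suc m < 2 ^ Suc m"
        using k m by auto
      then show ?thesis using R' m False by simp
    qed
  qed
  moreover have "(\<Sum>k<2 ^ n. \<bar>?p n k\<bar>) = 2 ^ n * ((F + F') / 2) \<and>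
      (\<Sum>k<2 ^ n. if 0 \<le> ?q n k then 1 else 0) = 2 ^ n * ((v + v') / 2)"
    if n: "Suc (max N N') \<le> n" for n
  proof -
    obtain m where m: "n = Suc m" "N \<le> m" "N' \<le> m" using n by (cases n) auto
    show ?thesis
      unfolding m(1) sum_glue[where h = abs] sum_glue[where h = "\<lambda>x. if 0 \<le> x then 1 else 0"]
      using R R' m by (simp add: algebra_simps)
  qed
  moreover have "?p 0 0 = (f + f') / 2" "?q 0 0 = (g + g') / 2" using R R' by simp_all
  ultimately show ?thesis unfolding realizes_def by blast
qed

lemma reach_realizes: "reach g f F v \<Longrightarrow> \<exists>p q N. realizes p q N g f F v"
proof (induction rule: reach.induct)
  case (leaf g f)
  have "realizes (\<lambda>_ _. f) (\<lambda>_ _. g) 0 g f \<bar>f\<bar> (if 0 \<le> g then 1 else 0)"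
    by (simp add: realizes_def)
  then show ?case by blast
next
  case (node g1 f1 F1 v1 g2 f2 F2 v2)
  then show ?case using realizes_glue by blast
qed

section \<open>Step functions with prescribed means on dyadic cells\<close>

definition step_fun :: "nat \<Rightarrow> (nat \<Rightarrow> real) \<Rightarrow> real \<Rightarrow> real" where
  "step_fun N a x = (\<Sum>k<2 ^ N. a k * indicator (dint N k) x)"

lemma step_fun_eq:
  assumes "k < 2 ^ N" "x \<in> dint N k"
  shows "step_fun N a x = a k"
proof -
  have "step_fun N a x = (\<Sum>i\<in>{k}. a i * indicator (dint N i) x)"
    unfolding step_fun_def
  proof (rule sum.mono_neutral_right)
    show "\<forall>i\<in>{..<2 ^ N} - {k}. a i * indicator (dint N i) x = 0"
      using assms(2) dint_disjoint by (auto simp: indicator_def)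
  qed (use assms in auto)
  then show ?thesis using assms by simp
qed

lemma step_fun_integrable: "set_integrable lebesgue I0 (step_fun N a)"
proof -
  have "integrable lebesgue (\<lambda>x. \<Sum>k<2 ^ N. a k * indicat_real (dint N k) x)"
    by (intro Bochner_Integration.integrable_sum integrable_mult_right)
      (use dint_lmeasurable in \<open>simp flip: lmeasurable_iff_integrable\<close>)
  then show ?thesis
    unfolding set_integrable_def step_fun_def[abs_def]
    by (intro integrable_mult_indicator) auto
qed

lemma step_fun_levels:
  assumes const: "\<And>n k. N \<le> n \<Longrightarrow> k < 2 ^ Suc n \<Longrightarrow> p (Suc n) k = p n (k div 2)"
    and "N \<le> n" "k < 2 ^ n" "x \<in> dint n k"
  shows "step_fun N (p N) x = p n k"
  using assms(2-)
proof (induction n arbitrary: k rule: dec_induct)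
  case base
  then show ?case by (simp add: step_fun_eq)
next
  case (step n)
  have "k div 2 < 2 ^ n" using step.prems(1) by auto
  then show ?case
    using step.IH[OF _ dint_parent[OF step.prems(2)]] const[OF step.hyps(1) step.prems(1)] by simp
qed

text \<open>From generation \<open>N\<close> on the function is constant on each cell; coarser
  generations follow by descending induction, since both sides average over the two
  children.\<close>

lemma mean_step_fun:
  assumes const: "\<And>n k. N \<le> n \<Longrightarrow> k < 2 ^ Suc n \<Longrightarrow> p (Suc n) k = p n (k div 2)"
    and halves: "\<And>n k. k < 2 ^ n \<Longrightarrow> p n k = (p (Suc n) (2 * k) + p (Suc n) (2 * k + 1)) / 2"
    and "k < 2 ^ n"
  shows "mean (step_fun N (p N)) n k = p n k"
proof -
  have fine: "mean (step_fun N (p N)) n k = p n k" if "N \<le> n" "k < 2 ^ n" for n k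
    using that step_fun_levels[of N p, OF const] by (intro mean_const) auto
  show ?thesis
  proof (cases "N \<le> n")
    case False
    then have "n \<le> N" by simp
    then show ?thesis using \<open>k < 2 ^ n\<close>
    proof (induction n arbitrary: k rule: inc_induct)
      case base
      then show ?case using fine by simp
    next
      case (step n)
      then have "2 * k < 2 ^ Suc n" "2 * k + 1 < 2 ^ Suc n" by auto
      then show ?case
        unfolding mean_halves[OF step_fun_integrable step.prems] halves[OF step.prems]
        using step.IH by simp
    qed
  qed (use fine assms(3) in simp)
qed

lemma realizes_transform:
  assumes "realizes p q N g f F v"
  defines "\<phi> \<equiv> step_fun N (p N)" and "\<psi> \<equiv> step_fun N (q N)"
  shows "martingale_transform \<phi> \<psi>" "avg I0 (\<lambda>x. \<bar>\<phi> x\<bar>) = F" "avg I0 \<phi> = f" "avg I0 \<psi> = g"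
    "len {x \<in> I0. 0 \<le> \<psi> x} = v"
proof -
  note R = assms(1)[unfolded realizes_def]
  have p_const: "\<And>n k. N \<le> n \<Longrightarrow> k < 2 ^ Suc n \<Longrightarrow> p (Suc n) k = p n (k div 2)"
    and q_const: "\<And>n k. N \<le> n \<Longrightarrow> k < 2 ^ Suc n \<Longrightarrow> q (Suc n) k = q n (k div 2)"
    and p_halves: "\<And>n k. k < 2 ^ n \<Longrightarrow> p n k = (p (Suc n) (2 * k) + p (Suc n) (2 * k + 1)) / 2"
    and q_halves: "\<And>n k. k < 2 ^ n \<Longrightarrow> q n k = (q (Suc n) (2 * k) + q (Suc n) (2 * k + 1)) / 2"
    and jumps: "\<And>n k. k < 2 ^ n \<Longrightarrow> \<bar>q (Suc n) (2 * k + 1) - q (Suc n) (2 * k)\<bar> =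
      \<bar>p (Suc n) (2 * k + 1) - p (Suc n) (2 * k)\<bar>"
    and root: "p 0 0 = f" "q 0 0 = g"
    and leaves: "(\<Sum>k<2 ^ N. \<bar>p N k\<bar>) = 2 ^ N * F" "(\<Sum>k<2 ^ N. if 0 \<le> q N k then 1 else 0) = 2 ^ N * v"
    using R by blast+
  have mean_p: "mean \<phi> n k = p n k" if "k < 2 ^ n" for n k
    unfolding \<phi>_def using p_const p_halves that by (rule mean_step_fun)
  have mean_q: "mean \<psi> n k = q n k" if "k < 2 ^ n" for n k
    unfolding \<psi>_def using q_const q_halves that by (rule mean_step_fun)
  have int: "set_integrable lebesgue I0 \<phi>" "set_integrable lebesgue I0 \<psi>"
    by (simp_all add: \<phi>_def \<psi>_def step_fun_integrable)
  show "avg I0 \<phi> = f" "avg I0 \<psi> = g"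
    using root mean_p[of 0 0] mean_q[of 0 0] by (simp_all add: avg_I0)
  have "(\<Sum>k<2 ^ N. mean (\<lambda>x. \<bar>\<phi> x\<bar>) N k) = (\<Sum>k<2 ^ N. \<bar>p N k\<bar>)"
    by (intro sum.cong refl mean_const) (simp add: \<phi>_def step_fun_eq)
  then show "avg I0 (\<lambda>x. \<bar>\<phi> x\<bar>) = F"
    using leaves(1) avg_eq_sum_mean[OF set_integrable_abs[OF int(1)], of N] by simp
  show "len {x \<in> I0. 0 \<le> \<psi> x} = v"
  proof -
    let ?A = "{x \<in> I0. 0 \<le> \<psi> x}"
    have meas: "?A \<in> sets lebesgue" using nonneg_set_measurable[OF int(2)] .
    have "?A \<in> lmeasurable" by (rule fmeasurableI2[of I0]) (use meas in auto)
    then have "integrable lebesgue (indicat_real ?A)"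
      by (simp only: lmeasurable_iff_integrable)
    then have "set_integrable lebesgue I0 (indicat_real ?A)"
      unfolding set_integrable_def by (intro integrable_mult_indicator) auto
    from avg_eq_sum_mean[OF this, of N]
    have "2 ^ N * avg I0 (indicat_real ?A) = (\<Sum>k<2 ^ N. mean (indicat_real ?A) N k)" by simp
    also have "\<dots> = (\<Sum>k<2 ^ N. if 0 \<le> q N k then 1 else 0)"
    proof (intro sum.cong refl mean_const)
      fix k x assume "k \<in> {..<2 ^ N}" "x \<in> dint N k"
      then show "indicat_real ?A x = (if 0 \<le> q N k then 1 else 0)"
        using dint_subset_I0[of k N] step_fun_eq[of k N x "q N"] by (auto simp: \<psi>_def indicator_def)
    qed
    also have "\<dots> = 2 ^ N * v" by (rule leaves(2))
    finally have "avg I0 (indicat_real ?A) = v" by simp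
    moreover have "avg I0 (indicat_real ?A) = len ?A"
    proof -
      have "indicat_real I0 x *\<^sub>R indicat_real ?A x = indicat_real ?A x" for x
        by (simp add: indicator_def)
      then have "(LINT x:I0|lebesgue. indicat_real ?A x) = (LINT x|lebesgue. indicat_real ?A x)"
        unfolding set_lebesgue_integral_def by (simp only:)
      also have "\<dots> = len ?A" by simp
      finally show ?thesis by (simp add: avg_def)
    qed
    ultimately show ?thesis by simp
  qed
  have coeffs: "\<bar>haar_coeff \<psi> (dint n k)\<bar> = \<bar>haar_coeff \<phi> (dint n k)\<bar>" if k: "k < 2 ^ n" for n k
  proof -
    have "2 * k < 2 ^ Suc n" "2 * k + 1 < 2 ^ Suc n" using k by auto
    then have "\<bar>haar_coeff \<psi> (dint n k) * sqrt (2 ^ n)\<bar> = \<bar>haar_coeff \<phi> (dint n k) * sqrt (2 ^ n)\<bar>"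
      using jumps[OF k] by (simp only: haar_coeff_dint[OF int(1) k] haar_coeff_dint[OF int(2) k]
          mean_p mean_q abs_divide)
    then show ?thesis by (simp add: abs_mult)
  qed
  \<comment> \<open>The coefficients agree up to sign, so whenever they differ they are
    opposite.\<close>
  define \<epsilon> :: "real set \<Rightarrow> real" where
    "\<epsilon> I = (if haar_coeff \<psi> I = haar_coeff \<phi> I then 1 else - 1)" for I
  have \<epsilon>: "\<epsilon> I * haar_coeff \<phi> I = haar_coeff \<psi> I" if I: "I \<in> dyadic_upto n" for I n
  proof -
    obtain j k where "k < 2 ^ j" "I = dint j k" using dyadic_upto_cases[OF I] by blast
    then show ?thesis using coeffs[of k j] by (auto simp: \<epsilon>_def abs_eq_iff)
  qed
  \<comment> \<open>The partial sum is the mean of \<psi> over a cell of generation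
    \<open>Suc n\<close>, on which \<psi> is constant. Hence it equals \<psi> exactly and the
    convergence is eventual equality.\<close>
  have partial: "avg I0 \<psi> + (\<Sum>I\<in>dyadic_upto n. \<epsilon> I * haar_coeff \<phi> I * haar I x) = \<psi> x"
    if n: "N \<le> n" and x: "x \<in> {0..<1}" for n x
  proof -
    obtain k where k: "k < 2 ^ Suc n" "x \<in> dint (Suc n) k"
      using x union_dint[of "Suc n"] by blast
    have "avg I0 \<psi> + (\<Sum>I\<in>dyadic_upto n. \<epsilon> I * haar_coeff \<phi> I * haar I x)
        = mean \<psi> 0 0 + (\<Sum>I\<in>dyadic_upto n. haar_coeff \<psi> I * haar I x)"
      by (simp add: \<epsilon> avg_I0)
    also have "\<dots> = mean \<psi> (Suc n) k"
    proof (rule haar_sum[OF _ k])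
      fix n k :: nat assume "k < 2 ^ Suc n"
      then have l: "k div 2 < 2 ^ n" by auto
      show "mean \<psi> (Suc n) k - mean \<psi> n (k div 2) =
          (if odd k then 1 else - 1) * haar_coeff \<psi> (dint n (k div 2)) * sqrt (2 ^ n)"
        using mean_halves[OF int(2) l] haar_coeff_dint[OF int(2) l]
        by (cases "even k") (auto simp: mult.assoc elim!: evenE oddE)
    qed
    also have "\<dots> = q (Suc n) k" by (rule mean_q[OF k(1)])
    also have "\<dots> = \<psi> x"
      unfolding \<psi>_def using q_const le_SucI[OF n] k by (rule step_fun_levels[symmetric])
    finally show ?thesis .
  qed
  have "AE x\<in>I0 in lebesgue.
     (\<lambda>n. avg I0 \<psi> + (\<Sum>I\<in>dyadic_upto n. \<epsilon> I * haar_coeff \<phi> I * haar I x)) \<longlonglongrightarrow> \<psi> x"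
    using AE_I0
  proof eventually_elim
    case (elim x)
    show ?case
    proof
      assume "x \<in> I0"
      then have "x \<in> {0..<1}" using elim by simp
      then show "(\<lambda>n. avg I0 \<psi> + (\<Sum>I\<in>dyadic_upto n. \<epsilon> I * haar_coeff \<phi> I * haar I x)) \<longlonglongrightarrow> \<psi> x"
        using partial by (intro tendsto_eventually) (auto simp: eventually_sequentially)
    qed
  qed
  moreover have "\<forall>I\<in>dyadic. I \<subseteq> I0 \<longrightarrow> \<epsilon> I \<in> {- 1, 1}" by (simp add: \<epsilon>_def)
  ultimately show "martingale_transform \<phi> \<psi>"
    unfolding martingale_transform_def using int by blast
qed

theorem theorem2p2:
  fixes g f F :: real
  assumes "(g, f, F) \<in> Omega"
  shows "bellman g f F = B g f F"
proof -
  have dom: "\<bar>f\<bar> \<le> F" using assms by (simp add: Omega_def)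
  define X where "X = {len {x \<in> I0. \<psi> x \<ge> 0} | \<phi> \<psi>. martingale_transform \<phi> \<psi> \<and>
      avg I0 (\<lambda>x. \<bar>\<phi> x\<bar>) = F \<and> avg I0 \<phi> = f \<and> avg I0 \<psi> = g}"
  have le: "x \<le> B g f F" if "x \<in> X" for x
    using that level_set_le_B dom unfolding X_def by blast
  have reach_X: "v \<in> X" if r: "reach g f F v" for v
  proof -
    obtain p q N where "realizes p q N g f F v" using reach_realizes[OF r] by blast
    from realizes_transform[OF this] show ?thesis unfolding X_def by blast
  qed
  \<comment> \<open>A real \<open>Sup\<close> has its meaning only for nonempty sets bounded above,
    so both properties are secured first.\<close>
  have bdd: "bdd_above X" using le by (rule bdd_aboveI)
  have "X \<noteq> {}" using reach_exists[OF dom, of g] reach_X by blast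
  then have "Sup X \<le> B g f F" using le by (rule cSup_least)
  moreover have "V g f F \<le> Sup X"
    using reach_X bdd by (intro V_least[OF dom] cSup_upper)
  then have "B g f F \<le> Sup X" using B_le_V[OF dom, of g] by linarith
  ultimately show ?thesis unfolding bellman_def X_def[symmetric] by (rule antisym)
qed

end
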